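(* Let $C$ be a conjugation on a separable complex Hilbert space $\mathcal{H}$, and let $\mathcal{N}_C(\mathcal{H})$ denote the set of all $C$-normal bounded linear operators on $\mathcal{H}$. Then $$\mathcal{N}_C(\mathcal{H})=\{CJP:\ P \text{ is a positive (bounded linear) operator on } \mathcal{H} \text{ and } J \text{ is an anti-unitary operator on } \mathcal{H} \text{ commuting with } P\}.$$
   Context: A conjugation on $\mathcal{H}$ is an anti-linear map $C:\mathcal{H}\to\mathcal{H}$ with $C^2=I$ and $\langle Cx,Cy\rangle=\langle y,x\rangle$ for all $x,y$. A bounded linear operator $T$ is $C$-normal if $C|T|C=|T^*|$ (equivalently $CT^*TC=TT^*$), where $|X|=(X^*X)^{1/2}$. An anti-unitary operator is a surjective anti-linear map $J:\mathcal{H}\to\mathcal{H}$ with $\langle Jx,Jy\rangle=\langle y,x\rangle$ for all $x,y$. Positive means positive semidefinite. *)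

theory Defs
  imports "HOL-Analysis.Analysis"
begin

text \<open>
  Complex inner product spaces are built on \<^class>\<open>real_inner\<close>, whose inner product is required to
  be the real part of the complex one.  Norm, topology and \<^const>\<open>bounded_linear\<close> are then those
  of the library, and positive definiteness of \<open>cinner\<close> is inherited.  The complex inner
  product is linear in its first argument.
\<close>

class complex_inner = real_inner +
  fixes scaleC :: "complex \<Rightarrow> 'a \<Rightarrow> 'a" (infixr \<open>*\<^sub>C\<close> 75)
    and cinner :: "'a \<Rightarrow> 'a \<Rightarrow> complex"
  assumes scaleC_add_right: "a *\<^sub>C (x + y) = a *\<^sub>C x + a *\<^sub>C y"
    and scaleC_add_left: "(a + b) *\<^sub>C x = a *\<^sub>C x + b *\<^sub>C x"
    and scaleC_scaleC: "a *\<^sub>C (b *\<^sub>C x) = (a * b) *\<^sub>C x"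
    and scaleC_of_real: "complex_of_real r *\<^sub>C x = r *\<^sub>R x"
    and cinner_commute: "cinner x y = cnj (cinner y x)"
    and cinner_add_left: "cinner (x + y) z = cinner x z + cinner y z"
    and cinner_scaleC_left: "cinner (a *\<^sub>C x) y = a * cinner x y"
    and inner_eq_Re_cinner: "inner x y = Re (cinner x y)"

class complex_hilbert = complex_inner + complete_space

instantiation complex :: complex_hilbert
begin

definition scaleC_complex :: "complex \<Rightarrow> complex \<Rightarrow> complex"
  where "scaleC_complex a x = a * x"

definition cinner_complex :: "complex \<Rightarrow> complex \<Rightarrow> complex"
  where "cinner_complex x y = x * cnj y"

instance
  by standard
    (auto simp: scaleC_complex_def cinner_complex_def inner_complex_def scaleR_conv_of_real
      algebra_simps)

end

definition bounded_clinear :: "('a::complex_inner \<Rightarrow> 'a) \<Rightarrow> bool"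
  where "bounded_clinear T \<longleftrightarrow> bounded_linear T \<and> (\<forall>a x. T (a *\<^sub>C x) = a *\<^sub>C T x)"

definition antilinear :: "('a::complex_inner \<Rightarrow> 'a) \<Rightarrow> bool"
  where "antilinear J \<longleftrightarrow>
    (\<forall>x y. J (x + y) = J x + J y) \<and> (\<forall>a x. J (a *\<^sub>C x) = cnj a *\<^sub>C J x)"

definition conjugation :: "('a::complex_inner \<Rightarrow> 'a) \<Rightarrow> bool"
  where "conjugation C \<longleftrightarrow>
    antilinear C \<and> C \<circ> C = id \<and> (\<forall>x y. cinner (C x) (C y) = cinner y x)"

definition anti_unitary :: "('a::complex_inner \<Rightarrow> 'a) \<Rightarrow> bool"
  where "anti_unitary J \<longleftrightarrow>
    antilinear J \<and> surj J \<and> (\<forall>x y. cinner (J x) (J y) = cinner y x)"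

definition positive_op :: "('a::complex_inner \<Rightarrow> 'a) \<Rightarrow> bool"
  where "positive_op P \<longleftrightarrow>
    bounded_clinear P \<and> (\<forall>x. cinner (P x) x \<in> \<real> \<and> 0 \<le> Re (cinner (P x) x))"

text \<open>
  The definite descriptions below denote the intended operators on a Hilbert space: the adjoint of
  a bounded operator by the Riesz representation theorem, and the unique positive square root of a
  positive operator.
\<close>

definition cadjoint :: "('a::complex_hilbert \<Rightarrow> 'a) \<Rightarrow> 'a \<Rightarrow> 'a"
  where "cadjoint T = (THE S. bounded_clinear S \<and> (\<forall>x y. cinner (T x) y = cinner x (S y)))"

definition op_sqrt :: "('a::complex_hilbert \<Rightarrow> 'a) \<Rightarrow> 'a \<Rightarrow> 'a"
  where "op_sqrt A = (THE S. positive_op S \<and> S \<circ> S = A)"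

definition op_abs :: "('a::complex_hilbert \<Rightarrow> 'a) \<Rightarrow> 'a \<Rightarrow> 'a"
  where "op_abs X = op_sqrt (cadjoint X \<circ> X)"

definition C_normal :: "('a::complex_hilbert \<Rightarrow> 'a) \<Rightarrow> ('a \<Rightarrow> 'a) \<Rightarrow> bool"
  where "C_normal C T \<longleftrightarrow> bounded_clinear T \<and> C \<circ> op_abs T \<circ> C = op_abs (cadjoint T)"

definition C_normal_ops :: "('a::complex_hilbert \<Rightarrow> 'a) \<Rightarrow> ('a \<Rightarrow> 'a) set"
  where "C_normal_ops C = {T. C_normal C T}"

end

theory Submission
  imports Defs
begin

text \<open>
  If \<open>V\<close> is unitary and \<open>P\<close> is positive, then \<open>\<bar>V P\<bar> = P\<close> and \<open>\<bar>(V P)\<^sup>*\<bar> = V P V\<inverse>\<close>, because these are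
  positive square roots and positive square roots are unique.  For \<open>V = C J\<close> with \<open>J\<close> anti-unitary,
  \<open>V\<inverse> = J\<inverse> C\<close>, so the condition \<open>C P C = V P V\<inverse>\<close> for \<open>C J P\<close> to be C-normal says that
  \<open>P = J P J\<inverse>\<close>, that is, that \<open>J\<close> commutes with \<open>P\<close> (\<open>C_normal_iff_commute\<close>).

  It remains to write a C-normal \<open>T\<close> as \<open>C J \<bar>T\<bar>\<close> with \<open>J\<close> anti-unitary
  (\<open>C_normal_imp_anti_unitary\<close>).  As \<open>T\<close> and \<open>\<bar>T\<bar>\<close> give all pairs of vectors the same inner products,
  \<open>\<bar>T\<bar>x \<mapsto> C T x\<close> is an anti-linear isometry from the range of \<open>\<bar>T\<bar>\<close> onto the range of \<open>C T\<close>.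
  A polar decomposition only extends to a unitary if the orthogonal complements of the two ranges
  have the same dimension.  Here they are even equal: a vector \<open>z\<close> is orthogonal to the range of \<open>C T\<close>
  iff \<open>\<bar>T\<^sup>*\<bar> C z = 0\<close>, which by C-normality is \<open>C \<bar>T\<bar> z = 0\<close>.  So it suffices to have an anti-unitary
  operator on the kernel of \<open>\<bar>T\<bar>\<close>, and every Hilbert space has one, namely a conjugation.  It is
  specified by the vectors that it fixes, as a maximal set of vectors with real inner products
  (\<open>maximal_real_subset\<close>).

  Both parts of \<open>J\<close> are thus prescribed on a set of vectors, and \<open>anti_unitary_extension\<close> extends any
  prescription that is compatible with the inner products and has a total domain and a total range.
  Besides this, the proof needs two facts that make \<open>cadjoint\<close> and \<open>op_sqrt\<close> meaningful: adjoints
  exist (by Riesz), and positive operators have unique positive square roots.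
\<close>

section \<open>Complex inner products in terms of real ones\<close>

instance complex_hilbert \<subseteq> banach ..

lemma scaleC_minus_one: "(-1) *\<^sub>C x = - (x::'a::complex_inner)"
  using scaleC_of_real[of "-1" x] by simp

lemma cinner_scaleC_right: "cinner x (a *\<^sub>C y) = cnj a * cinner x (y::'a::complex_inner)"
  by (metis cinner_commute cinner_scaleC_left complex_cnj_mult)

lemma cinner_add_right: "cinner x (y + z) = cinner x y + cinner x (z::'a::complex_inner)"
  by (metis cinner_commute cinner_add_left complex_cnj_add)

lemma cinner_eq_Complex_inner:
  "cinner x y = Complex (inner x y) (inner x (\<i> *\<^sub>C (y::'a::complex_inner)))"
  by (simp add: complex_eq_iff inner_eq_Re_cinner cinner_scaleC_right)

lemma cinner_diff_left: "cinner (x - y) z = cinner x z - cinner y (z::'a::complex_inner)"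
  by (metis cinner_add_left diff_add_cancel eq_diff_eq)

lemma cinner_zero_left [simp]: "cinner 0 (z::'a::complex_inner) = 0"
  using cinner_diff_left[of 0 0 z] by simp

lemma cinner_zero_right [simp]: "cinner (z::'a::complex_inner) 0 = 0"
  by (metis cinner_commute cinner_zero_left complex_cnj_zero)

lemma cinner_self: "cinner x x = complex_of_real ((norm (x::'a::complex_inner))\<^sup>2)"
proof -
  have "Im (cinner x x) = 0"
    using cinner_commute[of x x] by (metis Reals_cnj_iff complex_is_Real_iff)
  then show ?thesis
    by (simp add: complex_eq_iff power2_norm_eq_inner inner_eq_Re_cinner)
qed

lemma cinner_self_eq_iff: "cinner x x = cinner y y \<longleftrightarrow> norm x = norm (y::'a::complex_inner)"
  unfolding cinner_self by (simp only: of_real_eq_iff) (simp add: power2_eq_iff_nonneg)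

lemma cinner_eqI: "(\<And>z. cinner x z = cinner y z) \<Longrightarrow> x = (y::'a::complex_inner)"
  using cinner_self[of "x - y"] by (simp add: cinner_diff_left)

lemma cinner_eqI_right:
  assumes "\<And>z. cinner z x = cinner z (y::'a::complex_inner)"
  shows "x = y"
  by (rule cinner_eqI) (simp only: cinner_commute[of x] cinner_commute[of y] assms)

lemma cinner_eq_0_commute: "cinner x y = 0 \<longleftrightarrow> cinner y (x::'a::complex_inner) = 0"
  by (subst cinner_commute) simp

lemma eq_0_iff_cinner: "x = 0 \<longleftrightarrow> (\<forall>z. cinner z x = 0)" for x :: "'a::complex_inner"
  using cinner_eqI_right[of x 0] by auto

lemma inner_i_left: "inner (\<i> *\<^sub>C x) y = - inner x (\<i> *\<^sub>C (y::'a::complex_inner))"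
  by (simp add: inner_eq_Re_cinner cinner_scaleC_left cinner_scaleC_right)

lemma bounded_linear_scaleC: "bounded_linear (\<lambda>x::'a::complex_inner. a *\<^sub>C x)"
proof (rule bounded_linear_intro[where K = "cmod a"])
  fix x y :: 'a and r :: real
  show "a *\<^sub>C (x + y) = a *\<^sub>C x + a *\<^sub>C y"
    by (rule scaleC_add_right)
  show "a *\<^sub>C (r *\<^sub>R x) = r *\<^sub>R (a *\<^sub>C x)"
    by (simp add: scaleC_of_real[symmetric] scaleC_scaleC mult.commute)
  have "complex_of_real ((norm (a *\<^sub>C x))\<^sup>2) = complex_of_real ((norm x * cmod a)\<^sup>2)"
    unfolding cinner_self[symmetric] cinner_scaleC_left cinner_scaleC_right
    by (simp add: cinner_self power_mult_distrib complex_norm_square[of a] mult_ac del: of_real_power)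
  then have "(norm (a *\<^sub>C x))\<^sup>2 = (norm x * cmod a)\<^sup>2"
    by (simp only: of_real_eq_iff)
  then show "norm (a *\<^sub>C x) \<le> norm x * cmod a"
    by (simp add: power2_eq_iff_nonneg)
qed

lemma tendsto_cinner_left:
  "(f \<longlongrightarrow> x) F \<Longrightarrow> ((\<lambda>n. cinner (f n) y) \<longlongrightarrow> cinner x (y::'a::complex_inner)) F"
  unfolding cinner_eq_Complex_inner by (intro tendsto_intros)

text \<open>
  For a complex-linear operator, both symmetry and the adjoint relation can be checked on the real
  inner product, because the imaginary part of the complex one is the real one after
  multiplication by \<open>\<i>\<close>.
\<close>

lemma cinner_adjoint_iff_inner:
  fixes T S :: "'a::complex_inner \<Rightarrow> 'a"
  assumes "\<And>y. S (\<i> *\<^sub>C y) = \<i> *\<^sub>C S y"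
  shows "(\<forall>x y. cinner (T x) y = cinner x (S y)) \<longleftrightarrow> (\<forall>x y. inner (T x) y = inner x (S y))"
  unfolding cinner_eq_Complex_inner using assms by auto

section \<open>Orthogonal projection and adjoints\<close>

text \<open>
  By the parallelogram law, a sequence in \<open>M\<close> whose distances to \<open>x\<close> approach the infimum is Cauchy.
  Its limit is a nearest point, and the difference from a nearest point is orthogonal to \<open>M\<close>.
\<close>

lemma orthogonal_projection_exists:
  fixes M :: "'a::{real_inner,complete_space} set"
  assumes M: "subspace M" "closed M"
  obtains p where "p \<in> M" "\<And>m. m \<in> M \<Longrightarrow> inner (x - p) m = 0"
proof -
  define D where "D = (INF m\<in>M. (norm (x - m))\<^sup>2)"
  have bdd: "bdd_below ((\<lambda>m. (norm (x - m))\<^sup>2) ` M)"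
    by (rule bdd_belowI[of _ 0]) auto
  have ne: "M \<noteq> {}"
    using subspace_0[OF M(1)] by auto
  have D_le: "D \<le> (norm (x - m))\<^sup>2" if "m \<in> M" for m
    unfolding D_def using bdd that by (rule cINF_lower)
  have "\<exists>m\<in>M. (norm (x - m))\<^sup>2 < D + 1 / real (Suc n)" for n
  proof (rule ccontr)
    assume "\<not> ?thesis"
    then have "D + 1 / real (Suc n) \<le> D"
      unfolding D_def using ne by (intro cINF_greatest) (auto simp: D_def not_less)
    then show False by (simp add: field_simps)
  qed
  then obtain f where f: "\<And>n. f n \<in> M" "\<And>n. (norm (x - f n))\<^sup>2 < D + 1 / real (Suc n)"
    by metis
  \<comment> \<open>The midpoint of \<open>f j\<close> and \<open>f k\<close> lies in \<open>M\<close>, so it is no closer to \<open>x\<close> than the infimum.\<close>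
  have par: "(norm (f j - f k))\<^sup>2 \<le> 2 / real (Suc j) + 2 / real (Suc k)" for j k
  proof -
    have "(1/2) *\<^sub>R (f j + f k) \<in> M"
      using M(1) f(1) by (simp add: subspace_add subspace_scale)
    then have "D \<le> (norm (x - (1/2) *\<^sub>R (f j + f k)))\<^sup>2"
      by (rule D_le)
    moreover have "(norm (f j - f k))\<^sup>2 = 2 * (norm (x - f j))\<^sup>2 + 2 * (norm (x - f k))\<^sup>2
        - 4 * (norm (x - (1/2) *\<^sub>R (f j + f k)))\<^sup>2"
      by (simp add: power2_norm_eq_inner inner_commute algebra_simps)
    ultimately show ?thesis
      using f(2)[of j] f(2)[of k] by linarith
  qed
  have "Cauchy f"
  proof (rule metric_CauchyI)
    fix e :: real assume e: "0 < e"
    obtain N where N: "1 / real (Suc N) < e\<^sup>2 / 4"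
      using e by (metis nat_approx_posE zero_less_divide_iff zero_less_numeral zero_less_power)
    have "dist (f j) (f k) < e" if "j \<ge> N" "k \<ge> N" for j k
    proof -
      have "2 / real (Suc j) + 2 / real (Suc k) \<le> 2 / real (Suc N) + 2 / real (Suc N)"
        using that by (intro add_mono divide_left_mono) auto
      then have "(norm (f j - f k))\<^sup>2 < e\<^sup>2"
        using par[of j k] N by linarith
      then show ?thesis
        using e by (simp add: dist_norm power_less_imp_less_base)
    qed
    then show "\<exists>N. \<forall>m\<ge>N. \<forall>n\<ge>N. dist (f m) (f n) < e" by blast
  qed
  then obtain p where p: "f \<longlonglongrightarrow> p"
    using Cauchy_convergent convergent_def by blast
  have pM: "p \<in> M"
    using M(2) f(1) p by (meson closed_sequentially)
  have "(\<lambda>n. (norm (x - f n))\<^sup>2) \<longlonglongrightarrow> (norm (x - p))\<^sup>2"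
    by (intro tendsto_intros p)
  moreover have "(\<lambda>n. D + 1 / real (Suc n)) \<longlonglongrightarrow> D + 0"
    using LIMSEQ_inverse_real_of_nat by (intro tendsto_intros) (simp add: inverse_eq_divide)
  ultimately have "(norm (x - p))\<^sup>2 \<le> D"
    using f(2) by (intro LIMSEQ_le) (auto intro: less_imp_le)
  then have min: "(norm (x - p))\<^sup>2 \<le> (norm (x - m))\<^sup>2" if "m \<in> M" for m
    using D_le[OF that] by linarith
  have "inner (x - p) m = 0" if m: "m \<in> M" for m
  proof (cases "m = 0")
    case False
    \<comment> \<open>Moving \<open>p\<close> by the component of \<open>x - p\<close> along \<open>m\<close> would reduce the distance.\<close>
    define t where "t = inner (x - p) m / inner m m"
    have "p + t *\<^sub>R m \<in> M"
      using M(1) pM m by (simp add: subspace_add subspace_scale)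
    from min[OF this] have "0 \<le> t\<^sup>2 * inner m m - 2 * t * inner (x - p) m"
      unfolding power2_norm_eq_inner
      by (simp add: inner_commute algebra_simps power2_eq_square)
    also have "\<dots> = - (inner (x - p) m)\<^sup>2 / inner m m"
      using False by (simp add: t_def field_simps power2_eq_square)
    finally show ?thesis
      using False inner_gt_zero_iff[of m] by (auto simp: divide_le_0_iff simp del: inner_gt_zero_iff)
  qed simp
  with pM that show ?thesis by blast
qed

lemma closed_subspace_eq_UNIV:
  fixes M :: "'a::{real_inner,complete_space} set"
  assumes "subspace M" "closed M" and "\<And>z. (\<And>m. m \<in> M \<Longrightarrow> inner z m = 0) \<Longrightarrow> z = 0"
  shows "M = UNIV"
proof -
  have "x \<in> M" for x
  proof -
    obtain p where "p \<in> M" "\<And>m. m \<in> M \<Longrightarrow> inner (x - p) m = 0"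
      using orthogonal_projection_exists[OF assms(1,2)] by blast
    with assms(3)[of "x - p"] show ?thesis by simp
  qed
  then show ?thesis by blast
qed

text \<open>
  The representing vector spans the orthogonal complement of the kernel of \<open>f\<close>.
\<close>

lemma riesz_representation:
  fixes f :: "'a::{real_inner,complete_space} \<Rightarrow> real"
  assumes f: "bounded_linear f"
  obtains y where "\<And>x. f x = inner x y"
proof (cases "\<forall>x. f x = 0")
  case True
  then show ?thesis using that[of 0] by simp
next
  case False
  then obtain u where u: "f u \<noteq> 0" by blast
  interpret f: bounded_linear f by (rule f)
  have M: "subspace {x. f x = 0}"
    by (simp add: subspace_def f.add f.scale)
  have M': "closed {x. f x = 0}"
    by (intro closed_Collect_eq continuous_intros linear_continuous_on f)
  obtain p where p: "f p = 0" "\<And>m. f m = 0 \<Longrightarrow> inner (u - p) m = 0"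
    using orthogonal_projection_exists[OF M M', of u] by auto
  define w where "w = u - p"
  have w: "f w \<noteq> 0"
    using u p(1) by (simp add: w_def f.diff)
  then have "w \<noteq> 0" using f.zero by auto
  have "f x = inner x ((f w / inner w w) *\<^sub>R w)" for x
  proof -
    have "f (f w *\<^sub>R x - f x *\<^sub>R w) = 0"
      by (simp add: f.diff f.scale mult.commute)
    then have "inner w (f w *\<^sub>R x - f x *\<^sub>R w) = 0"
      using p(2) by (simp add: w_def)
    then show ?thesis
      using \<open>w \<noteq> 0\<close> by (simp add: inner_diff_right inner_commute field_simps)
  qed
  then show ?thesis by (rule that)
qed

lemma cadjoint_eqI:
  assumes "bounded_clinear S" "\<And>x y. cinner (T x) y = cinner x (S y)"
  shows "cadjoint T = S"
  unfolding cadjoint_def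
proof (rule the_equality)
  fix S' assume "bounded_clinear S' \<and> (\<forall>x y. cinner (T x) y = cinner x (S' y))"
  with assms(2) have "cinner x (S' y) = cinner x (S y)" for x y
    by metis
  then have "S' y = S y" for y
    by (rule cinner_eqI_right)
  then show "S' = S" by blast
qed (use assms in blast)

text \<open>
  Riesz for the real inner product yields a real-linear adjoint.  It is complex-linear because, being
  determined by \<open>T\<close>, it commutes with multiplication by \<open>\<i>\<close> when \<open>T\<close> does.
\<close>

lemma bounded_clinear_cadjoint:
  assumes T: "bounded_clinear T"
  shows "bounded_clinear (cadjoint T)" "cinner (T x) y = cinner x (cadjoint T y)"
proof -
  have lin: "bounded_linear T" and i: "\<And>a x. T (a *\<^sub>C x) = a *\<^sub>C T x"
    using T by (auto simp: bounded_clinear_def)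
  interpret T: bounded_linear T by (rule lin)
  have "\<exists>z. \<forall>x. inner (T x) y = inner x z" for y
    using riesz_representation[OF bounded_linear_compose[OF bounded_linear_inner_left[of y] lin]]
    by metis
  then obtain S where S: "\<And>x y. inner (T x) y = inner x (S y)"
    by metis
  have ext: "a = b" if "\<And>x. inner x a = inner x b" for a b :: 'a
  proof -
    have "inner (a - b) (a - b) = inner (a - b) a - inner (a - b) b"
      by (rule inner_diff_right)
    then have "inner (a - b) (a - b) = 0"
      by (simp only: that diff_self)
    then show ?thesis by simp
  qed
  have add: "S (x + y) = S x + S y" for x y
    by (rule ext) (simp add: S[symmetric] inner_add_right)
  have scale: "S (r *\<^sub>R x) = r *\<^sub>R S x" for r x
    by (rule ext) (simp add: S[symmetric])
  have S_i: "S (\<i> *\<^sub>C x) = \<i> *\<^sub>C S x" for x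
  proof (rule ext)
    fix z
    have "inner z (S (\<i> *\<^sub>C x)) = - inner (T (\<i> *\<^sub>C z)) x"
      by (simp add: S[symmetric] i inner_i_left)
    then show "inner z (S (\<i> *\<^sub>C x)) = inner z (\<i> *\<^sub>C S x)"
      by (simp add: S inner_i_left)
  qed
  obtain K where K: "\<And>x. norm (T x) \<le> norm x * K" "K > 0"
    using T.pos_bounded by blast
  have bnd: "norm (S y) \<le> norm y * K" for y
  proof (cases "S y = 0")
    case False
    have "(norm (S y))\<^sup>2 = inner (T (S y)) y"
      by (simp add: S power2_norm_eq_inner)
    also have "\<dots> \<le> norm (S y) * K * norm y"
      using norm_cauchy_schwarz[of "T (S y)" y] K(1)[of "S y"]
      by (meson mult_right_mono norm_ge_zero order_trans)
    finally show ?thesis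
      using False by (simp add: power2_eq_square mult_ac)
  qed (use K in simp)
  have lS: "bounded_linear S"
    using add scale bnd by (rule bounded_linear_intro)
  have S_C: "S (a *\<^sub>C x) = a *\<^sub>C S x" for a x
  proof -
    have "a *\<^sub>C z = Re a *\<^sub>R z + Im a *\<^sub>R (\<i> *\<^sub>C z)" for z :: 'a
      by (simp add: scaleC_of_real[symmetric] scaleC_scaleC mult.commute[of _ \<i>]
          complex_eq[symmetric] flip: scaleC_add_left)
    then show ?thesis by (simp add: add scale S_i)
  qed
  have bS: "bounded_clinear S"
    using lS S_C by (simp add: bounded_clinear_def)
  have adj: "\<And>x y. cinner (T x) y = cinner x (S y)"
    using cinner_adjoint_iff_inner[of S T] S_i S by blast
  show "bounded_clinear (cadjoint T)" "cinner (T x) y = cinner x (cadjoint T y)"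
    using cadjoint_eqI[OF bS adj] bS adj by simp_all
qed

lemma cadjoint_cadjoint:
  assumes "bounded_clinear T"
  shows "cadjoint (cadjoint T) = T"
proof (rule cadjoint_eqI[OF assms])
  show "cinner (cadjoint T x) y = cinner x (T y)" for x y
    using bounded_clinear_cadjoint(2)[OF assms, of y x]
      cinner_commute[of "cadjoint T x" y] cinner_commute[of x "T y"] by simp
qed

section \<open>Positive operators and their square roots\<close>

lemma positive_opI:
  assumes P: "bounded_clinear P"
    and sym: "\<And>x y. inner (P x) y = inner x (P y)" and pos: "\<And>x. 0 \<le> inner (P x) x"
  shows "positive_op P"
proof -
  have "inner (P x) (\<i> *\<^sub>C x) = - inner (P x) (\<i> *\<^sub>C x)" for x
    using sym[of x "\<i> *\<^sub>C x"] P inner_i_left[of x "P x"]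
    by (simp add: bounded_clinear_def inner_commute)
  then have "cinner (P x) x \<in> \<real>" for x
    by (simp add: complex_is_Real_iff cinner_eq_Complex_inner)
  with P pos show ?thesis
    by (simp add: positive_op_def inner_eq_Re_cinner)
qed

text \<open>
  Polarisation: \<open>\<langle>P z, z\<rangle>\<close> is real at \<open>z = x + \<i> y\<close>, \<open>x\<close> and \<open>y\<close>, and the imaginary part of the cross
  terms at \<open>x + \<i> y\<close> is, up to sign, the difference of the two sides.
\<close>

lemma positive_op_inner_sym:
  assumes P: "positive_op P"
  shows "inner (P x) y = inner x (P y)"
proof -
  have i: "P (\<i> *\<^sub>C y) = \<i> *\<^sub>C P y" and add: "P (x + \<i> *\<^sub>C y) = P x + P (\<i> *\<^sub>C y)"
    using P by (auto simp: positive_op_def bounded_clinear_def linear_simps)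
  have "Im (cinner (P z) z) = 0" for z
    using P by (simp add: positive_op_def complex_is_Real_iff)
  from this[of "x + \<i> *\<^sub>C y"] this[of x] this[of y] show ?thesis
    by (simp add: add i cinner_add_left cinner_add_right cinner_scaleC_left cinner_scaleC_right
        inner_commute[of x "P y"]) (simp add: inner_eq_Re_cinner)
qed

lemma positive_op_cinner_sym:
  assumes P: "positive_op P"
  shows "cinner (P x) y = cinner x (P y)"
  using cinner_adjoint_iff_inner[of P P] positive_op_inner_sym[OF P] P
  by (auto simp: positive_op_def bounded_clinear_def)

text \<open>
  The operator inequality \<open>P\<^sup>2 \<le> K P\<close> for \<open>0 \<le> P \<le> K\<close>.  It bounds \<open>I - A / K\<close> in the construction of
  square roots, and it shows that the null vectors of the quadratic form of \<open>P\<close> form its kernel.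
\<close>

lemma positive_op_norm_square_le:
  assumes P: "positive_op P" and K: "0 < K" "\<And>x. norm (P x) \<le> K * norm x"
  shows "(norm (P x))\<^sup>2 \<le> K * inner (P x) x"
proof -
  interpret P: bounded_linear P
    using P by (simp add: positive_op_def bounded_clinear_def)
  have "inner (P (P x)) (P x) \<le> norm (P (P x)) * norm (P x)"
    by (rule norm_cauchy_schwarz)
  also have "\<dots> \<le> K * (norm (P x))\<^sup>2"
    using mult_right_mono[OF K(2)[of "P x"] norm_ge_zero[of "P x"]]
    by (simp add: power2_eq_square mult_ac)
  finally have le: "inner (P (P x)) (P x) \<le> K * (norm (P x))\<^sup>2" .
  \<comment> \<open>Positivity at the vector where the quadratic bound in the step size is smallest.\<close>
  define y where "y = K *\<^sub>R x - P x"
  have "0 \<le> inner (P y) y"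
    using P by (simp add: positive_op_def inner_eq_Re_cinner)
  also have "\<dots> = K\<^sup>2 * inner (P x) x - 2 * K * (norm (P x))\<^sup>2 + inner (P (P x)) (P x)"
    using positive_op_inner_sym[OF P, of "P x" x]
    by (simp add: y_def P.diff P.scale power2_norm_eq_inner inner_diff_left inner_diff_right)
      (simp add: power2_eq_square algebra_simps)
  also have "\<dots> \<le> K * (K * inner (P x) x - (norm (P x))\<^sup>2)"
    using le by (simp add: power2_eq_square algebra_simps)
  finally show ?thesis
    using K(1) by (simp add: zero_le_mult_iff)
qed

lemma positive_op_eq_0:
  assumes P: "positive_op P" and "inner (P x) x = 0"
  shows "P x = 0"
proof -
  have "bounded_linear P"
    using P by (simp add: positive_op_def bounded_clinear_def)
  then obtain K where "0 < K" "\<And>x. norm (P x) \<le> K * norm x"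
    using bounded_linear.pos_bounded by (metis mult.commute)
  from positive_op_norm_square_le[OF P this, of x] assms(2) show ?thesis
    by simp
qed

text \<open>
  A solution \<open>Y\<close> of \<open>2 Y = B + Y\<^sup>2\<close> satisfies \<open>(I - Y)\<^sup>2 = I - B\<close>.  It is the norm limit of the iteration
  \<open>X \<mapsto> (B + X\<^sup>2) / 2\<close> from \<open>0\<close>.  Although this is not a uniform contraction when \<open>\<parallel>B\<parallel> = 1\<close>, each
  step is at most as long as that of the scalar iteration \<open>z \<mapsto> (1 + z\<^sup>2) / 2\<close> from \<open>0\<close>, which is
  increasing and bounded by \<open>1\<close>.  The last conclusion is an induction principle: it transfers
  properties of \<open>B\<close>, such as symmetry or commutation with a given operator, to \<open>Y\<close>.
\<close>

lemma half_square_fixed_point: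
  fixes B :: "'a::banach \<Rightarrow>\<^sub>L 'a"
  assumes B: "norm B \<le> 1"
  obtains Y where "norm Y \<le> 1" "Y = (1/2) *\<^sub>R (B + (Y o\<^sub>L Y))"
    "\<And>Q. closed Q \<Longrightarrow> 0 \<in> Q \<Longrightarrow> (\<And>Z. Z \<in> Q \<Longrightarrow> (1/2) *\<^sub>R (B + (Z o\<^sub>L Z)) \<in> Q) \<Longrightarrow> Y \<in> Q"
proof -
  define X where "X = rec_nat 0 (\<lambda>_ Z. (1/2) *\<^sub>R (B + (Z o\<^sub>L Z)))"
  have X0: "X 0 = 0" and XS: "X (Suc n) = (1/2) *\<^sub>R (B + (X n o\<^sub>L X n))" for n
    by (simp_all add: X_def)
  define x :: "nat \<Rightarrow> real" where "x = rec_nat 0 (\<lambda>_ z. (1/2) * (1 + z * z))"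
  have x0: "x 0 = 0" and xS: "x (Suc n) = (1/2) * (1 + x n * x n)" for n
    by (simp_all add: x_def)
  have x01: "0 \<le> x n \<and> x n \<le> 1" for n
  proof (induction n)
    case (Suc n)
    then have "x n * x n \<le> 1 * 1" by (intro mult_mono) auto
    then show ?case by (simp add: xS)
  qed (simp add: x0)
  have x_le: "x n \<le> x (Suc n)" for n
    using zero_le_power2[of "1 - x n"] by (simp add: xS power2_eq_square algebra_simps)
  have X_le: "norm (X n) \<le> x n" for n
  proof (induction n)
    case (Suc n)
    have "norm (X n o\<^sub>L X n) \<le> x n * x n"
      using norm_blinfun_compose[of "X n" "X n"] Suc x01[of n]
      by (meson mult_mono norm_ge_zero order_trans)
    then have "norm (B + (X n o\<^sub>L X n)) \<le> 1 + x n * x n"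
      using norm_triangle_ineq[of B "X n o\<^sub>L X n"] B by linarith
    then show ?case by (simp add: XS xS)
  qed (simp add: X0 x0)
  have X_diff: "norm (X (Suc n) - X n) \<le> x (Suc n) - x n" for n
  proof (induction n)
    case 0
    then show ?case using B by (simp add: XS X0 xS x0)
  next
    case (Suc n)
    let ?D = "X (Suc n) - X n" and ?d = "x (Suc n) - x n"
    \<comment> \<open>\<open>U\<^sup>2 - W\<^sup>2 = U (U - W) + (U - W) W\<close> holds even if \<open>U\<close> and \<open>W\<close> do not commute.\<close>
    have "X (Suc (Suc n)) - X (Suc n) = (1/2) *\<^sub>R ((X (Suc n) o\<^sub>L X (Suc n)) - (X n o\<^sub>L X n))"
      by (simp only: XS[of "Suc n"] XS[of n] scaleR_diff_right[symmetric] add_diff_cancel_left)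
    also have "\<dots> = (1/2) *\<^sub>R ((X (Suc n) o\<^sub>L ?D) + (?D o\<^sub>L X n))"
      by (simp add: bounded_bilinear.diff_left[OF bounded_bilinear_blinfun_compose]
          bounded_bilinear.diff_right[OF bounded_bilinear_blinfun_compose])
    finally have eq: "X (Suc (Suc n)) - X (Suc n) = \<dots>" .
    have "norm ((X (Suc n) o\<^sub>L ?D) + (?D o\<^sub>L X n)) \<le> norm (X (Suc n)) * norm ?D + norm ?D * norm (X n)"
      by (intro order_trans[OF norm_triangle_ineq] add_mono norm_blinfun_compose)
    also have "\<dots> \<le> x (Suc n) * ?d + ?d * x n"
      using Suc X_le x01 x_le by (intro add_mono mult_mono) auto
    also have "\<dots> = 2 * (x (Suc (Suc n)) - x (Suc n))"
      by (simp add: xS[of "Suc n"] xS[of n] algebra_simps)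
    finally show ?case unfolding eq by simp
  qed
  have "norm (X (n + k) - X n) \<le> x (n + k) - x n" for n k
  proof (induction k)
    case (Suc k)
    have "norm (X (n + Suc k) - X n) \<le> norm (X (Suc (n + k)) - X (n + k)) + norm (X (n + k) - X n)"
      using norm_triangle_ineq[of "X (Suc (n + k)) - X (n + k)" "X (n + k) - X n"] by simp
    with Suc X_diff[of "n + k"] show ?case by simp
  qed simp
  then have "dist (X (n + k)) (X n) \<le> dist (x (n + k)) (x n)" for n k
    by (metis abs_ge_self dist_norm order_trans real_norm_def)
  then have "dist (X m) (X n) \<le> dist (x m) (x n)" for m n
    using nat_le_linear[of m n] by (auto simp: nat_le_iff_add dist_commute)
  moreover have "Cauchy x"
    using x01 x_le by (intro convergent_Cauchy Bseq_mono_convergent BseqI'[of _ 1])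
      (auto intro: lift_Suc_mono_le)
  ultimately have "Cauchy X"
    unfolding Cauchy_def by (meson le_less_trans)
  then obtain Y where Y: "X \<longlonglongrightarrow> Y"
    using Cauchy_convergent convergent_def by blast
  show ?thesis
  proof (rule that)
    have "norm (X n) \<le> 1" for n
      using X_le[of n] x01[of n] by simp
    with Y show "norm Y \<le> 1"
      by (intro LIMSEQ_le_const2[OF tendsto_norm]) auto
    have "(\<lambda>n. X (Suc n)) \<longlonglongrightarrow> (1/2) *\<^sub>R (B + (Y o\<^sub>L Y))"
      unfolding XS
      by (intro tendsto_intros bounded_bilinear.tendsto[OF bounded_bilinear_blinfun_compose] Y)
    then show "Y = (1/2) *\<^sub>R (B + (Y o\<^sub>L Y))"
      using LIMSEQ_Suc[OF Y] LIMSEQ_unique by blast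
    show "Y \<in> Q" if Q: "closed Q" "0 \<in> Q" "\<And>Z. Z \<in> Q \<Longrightarrow> (1/2) *\<^sub>R (B + (Z o\<^sub>L Z)) \<in> Q" for Q
    proof -
      have "X n \<in> Q" for n
        by (induction n) (simp_all add: X0 XS Q)
      with Q(1) Y show ?thesis by (meson closed_sequentially)
    qed
  qed
qed

text \<open>
  For \<open>K\<close> bounding \<open>A\<close> and \<open>B = I - A / K\<close>, the root is \<open>\<surd>K (I - Y)\<close>, where \<open>2 Y = B + Y\<^sup>2\<close>; it is positive
  because \<open>\<parallel>Y\<parallel> \<le> 1\<close>.  That it commutes with everything that commutes with \<open>A\<close> gives both its
  complex-linearity and the uniqueness of positive roots.
\<close>

lemma positive_sqrt_exists:
  fixes A :: "'a::complex_hilbert \<Rightarrow> 'a"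
  assumes A: "positive_op A"
  obtains S where "positive_op S" "S \<circ> S = A"
    "\<And>R. bounded_linear R \<Longrightarrow> R \<circ> A = A \<circ> R \<Longrightarrow> R \<circ> S = S \<circ> R"
proof -
  have lin: "bounded_linear A" and A_C: "\<And>a x. A (a *\<^sub>C x) = a *\<^sub>C A x"
    using A by (auto simp: positive_op_def bounded_clinear_def)
  obtain K where K: "0 < K" "\<And>x. norm (A x) \<le> K * norm x"
    using bounded_linear.pos_bounded[OF lin] by (metis mult.commute)
  define B where "B = Blinfun (\<lambda>x. x - (1/K) *\<^sub>R A x)"
  have B: "blinfun_apply B x = x - (1/K) *\<^sub>R A x" for x
    unfolding B_def using lin
    by (subst bounded_linear_Blinfun_apply) (auto intro!: bounded_linear_intros)
  have "norm (blinfun_apply B x) \<le> 1 * norm x" for x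
  proof -
    have "(norm (B x))\<^sup>2 = (norm x)\<^sup>2 - (2/K) * inner (A x) x + (1/K)\<^sup>2 * (norm (A x))\<^sup>2"
      unfolding power2_norm_eq_inner using K(1)
      by (simp add: B inner_diff_left inner_diff_right inner_commute[of x "A x"] field_simps
          power2_eq_square)
    also have "\<dots> \<le> (norm x)\<^sup>2 - (2/K) * inner (A x) x + (1/K)\<^sup>2 * (K * inner (A x) x)"
      by (intro add_left_mono mult_left_mono positive_op_norm_square_le A K) simp
    also have "\<dots> = (norm x)\<^sup>2 - inner (A x) x / K"
      using K(1) by (simp add: field_simps power2_eq_square)
    also have "\<dots> \<le> (norm x)\<^sup>2"
      using K(1) A by (simp add: positive_op_def inner_eq_Re_cinner)
    finally show ?thesis by (simp add: power2_le_iff_abs_le)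
  qed
  then have "norm B \<le> 1"
    by (intro norm_blinfun_bound) auto
  from half_square_fixed_point[OF this] obtain Y where Y: "norm Y \<le> 1"
      "Y = (1/2) *\<^sub>R (B + (Y o\<^sub>L Y))"
    and ind: "\<And>Q. closed Q \<Longrightarrow> 0 \<in> Q \<Longrightarrow> (\<And>Z. Z \<in> Q \<Longrightarrow> (1/2) *\<^sub>R (B + (Z o\<^sub>L Z)) \<in> Q) \<Longrightarrow> Y \<in> Q"
    by metis
  have app: "continuous_on UNIV (\<lambda>Z::'a \<Rightarrow>\<^sub>L 'a. blinfun_apply Z x)" for x
    by (intro continuous_intros)
  have comm: "R (Y x) = Y (R x)" if R: "bounded_linear R" "R \<circ> A = A \<circ> R" for R x
  proof -
    interpret R: bounded_linear R by (rule R(1))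
    have RA: "R (A x) = A (R x)" for x
      using R(2) by (metis comp_apply)
    have "Y \<in> {Z. \<forall>x. R (blinfun_apply Z x) = Z (R x)}"
    proof (rule ind)
      show "closed {Z. \<forall>x. R (blinfun_apply Z x) = Z (R x)}"
        by (intro closed_Collect_all closed_Collect_eq bounded_linear.continuous_on[OF R(1)] app)
    qed (auto simp: R.zero R.scale R.add R.diff blinfun.bilinear_simps B RA)
    then show ?thesis by simp
  qed
  have sym: "inner (Y x) y = inner x (Y y)" for x y
  proof -
    have "Y \<in> {Z. \<forall>x y. inner (blinfun_apply Z x) y = inner x (Z y)}"
      by (rule ind)
        (auto simp: blinfun.bilinear_simps B inner_diff_left inner_diff_right inner_add_left
          inner_add_right positive_op_inner_sym[OF A]
          intro!: closed_Collect_all closed_Collect_eq continuous_intros)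
    then show ?thesis by simp
  qed
  define S where "S x = sqrt K *\<^sub>R (x - Y x)" for x
  have lS: "bounded_linear S"
    unfolding S_def[abs_def] by (intro bounded_linear_intros)
  show ?thesis
  proof (rule that)
    show comm_S: "R \<circ> S = S \<circ> R" if R: "bounded_linear R" "R \<circ> A = A \<circ> R" for R
      using comm[OF R] by (auto simp: S_def fun_eq_iff linear_simps[OF R(1)])
    have "(\<lambda>x. a *\<^sub>C x) \<circ> S = S \<circ> (\<lambda>x. a *\<^sub>C x)" for a
      by (rule comm_S[OF bounded_linear_scaleC]) (simp add: fun_eq_iff A_C)
    then have "bounded_clinear S"
      using lS by (simp add: bounded_clinear_def fun_eq_iff)
    moreover have "0 \<le> inner (S x) x" for x
    proof -
      have "norm (Y x) \<le> norm x"
        using norm_blinfun[of Y x] Y(1) by (meson mult_left_le_one_le norm_ge_zero order_trans)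
      then have "inner (Y x) x \<le> inner x x"
        using norm_cauchy_schwarz[of "Y x" x]
        by (smt (verit) mult_right_mono norm_ge_zero power2_norm_eq_inner power2_eq_square)
      then show ?thesis
        using K(1) by (simp add: S_def inner_diff_left)
    qed
    ultimately show "positive_op S"
      by (intro positive_opI) (auto simp: S_def inner_diff_left inner_diff_right sym)
    have "S (S x) = A x" for x
    proof -
      have "2 *\<^sub>R Y x = B x + Y (Y x)"
        by (subst Y(2)) (simp add: blinfun.bilinear_simps)
      then have "Y (Y x) = 2 *\<^sub>R Y x - (x - (1/K) *\<^sub>R A x)"
        by (simp add: B)
      then have "x - Y x - Y (x - Y x) = (1/K) *\<^sub>R A x"
        by (simp add: blinfun.bilinear_simps scaleR_2)
      then show ?thesis
        using K(1) by (simp add: S_def blinfun.scaleR_right flip: scaleR_diff_right)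
    qed
    then show "S \<circ> S = A" by (simp add: fun_eq_iff)
  qed
qed

text \<open>
  For \<open>y = (S - R) x\<close> one has \<open>(S + R) y = (S\<^sup>2 - R\<^sup>2) x = 0\<close>, so both quadratic forms vanish at \<open>y\<close>,
  hence \<open>S y = R y = 0\<close> and \<open>\<parallel>y\<parallel>\<^sup>2 = \<langle>x, (S - R) y\<rangle> = 0\<close>.
\<close>

lemma commuting_positive_sqrt_unique:
  assumes S: "positive_op S" and R: "positive_op R"
    and eq: "S \<circ> S = R \<circ> R" and comm: "R \<circ> S = S \<circ> R"
  shows "S = R"
proof
  fix x
  interpret S: bounded_linear S
    using S by (simp add: positive_op_def bounded_clinear_def)
  interpret R: bounded_linear R
    using R by (simp add: positive_op_def bounded_clinear_def)
  define y where "y = S x - R x"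
  have "S y + R y = 0"
    using eq comm by (simp add: y_def S.diff R.diff fun_eq_iff)
  then have "inner (S y) y + inner (R y) y = 0"
    by (simp flip: inner_add_left)
  moreover have "0 \<le> inner (S y) y" "0 \<le> inner (R y) y"
    using S R by (auto simp: positive_op_def inner_eq_Re_cinner)
  ultimately have "S y = 0" "R y = 0"
    using positive_op_eq_0[OF S] positive_op_eq_0[OF R] by auto
  moreover have "inner y y = inner x (S y - R y)"
    by (simp add: y_def[symmetric] inner_diff_right flip: positive_op_inner_sym[OF S]
      positive_op_inner_sym[OF R] inner_diff_left)
  ultimately have "y = 0" by simp
  then show "S x = R x" by (simp add: y_def)
qed

lemma positive_op_square:
  assumes "positive_op S"
  shows "positive_op (S \<circ> S)"
proof (rule positive_opI)
  show "bounded_clinear (S \<circ> S)"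
    using assms by (auto simp: positive_op_def bounded_clinear_def o_def intro: bounded_linear_compose)
  show "inner ((S \<circ> S) x) y = inner x ((S \<circ> S) y)" for x y
    by (simp add: positive_op_inner_sym[OF assms])
  show "0 \<le> inner ((S \<circ> S) x) x" for x
    using positive_op_inner_sym[OF assms, of "S x" x] by simp
qed

lemma op_sqrt_square:
  assumes S: "positive_op S"
  shows "op_sqrt (S \<circ> S) = S"
  unfolding op_sqrt_def
proof (rule the_equality)
  obtain Q where Q: "positive_op Q" "Q \<circ> Q = S \<circ> S"
      "\<And>R. bounded_linear R \<Longrightarrow> R \<circ> (S \<circ> S) = (S \<circ> S) \<circ> R \<Longrightarrow> R \<circ> Q = Q \<circ> R"
    using positive_sqrt_exists[OF positive_op_square[OF S]] by blast
  have *: "Q = R" if R: "positive_op R" "R \<circ> R = S \<circ> S" for R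
  proof (rule commuting_positive_sqrt_unique[OF Q(1) R(1)])
    show "R \<circ> Q = Q \<circ> R"
      using R by (intro Q(3)) (auto simp: positive_op_def bounded_clinear_def o_assoc
          simp flip: R(2))
  qed (simp add: Q(2) R(2))
  fix R assume "positive_op R \<and> R \<circ> R = S \<circ> S"
  then have "Q = R" by (intro *) auto
  with *[OF S refl] show "R = S" by simp
qed (use S in simp)

lemma op_abs:
  assumes T: "bounded_clinear T"
  shows "positive_op (op_abs T)" "op_abs T \<circ> op_abs T = cadjoint T \<circ> T"
proof -
  have adj: "\<And>x y. cinner (T x) y = cinner x (cadjoint T y)" "bounded_clinear (cadjoint T)"
    using bounded_clinear_cadjoint[OF T] by auto
  have "positive_op (cadjoint T \<circ> T)"
  proof (rule positive_opI)
    show "bounded_clinear (cadjoint T \<circ> T)"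
      using T adj(2) by (auto simp: bounded_clinear_def o_def intro: bounded_linear_compose)
    have "inner x (cadjoint T (T y)) = inner (T x) (T y)" for x y
      by (simp add: inner_eq_Re_cinner adj(1))
    then show "inner ((cadjoint T \<circ> T) x) y = inner x ((cadjoint T \<circ> T) y)"
      "0 \<le> inner ((cadjoint T \<circ> T) x) x" for x y
      by (simp_all add: inner_commute[of "cadjoint T _"] inner_commute[of "T y"])
  qed
  then obtain S where "positive_op S" "S \<circ> S = cadjoint T \<circ> T"
    using positive_sqrt_exists by blast
  then show "positive_op (op_abs T)" "op_abs T \<circ> op_abs T = cadjoint T \<circ> T"
    using op_sqrt_square[of S] by (auto simp: op_abs_def)
qed

lemma cinner_op_abs:
  assumes "bounded_clinear T"
  shows "cinner (op_abs T x) (op_abs T y) = cinner (T x) (T y)"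
  using op_abs[OF assms] bounded_clinear_cadjoint(2)[OF assms] positive_op_cinner_sym
  by (metis comp_apply)

lemma op_abs_eq_0_iff:
  assumes "bounded_clinear T"
  shows "op_abs T x = 0 \<longleftrightarrow> T x = 0"
  using cinner_op_abs[OF assms, of x x] by (metis cinner_self_eq_iff norm_eq_zero)

text \<open>
  As \<open>V\<^sup>* = V\<inverse>\<close>, the products \<open>(V P)\<^sup>* (V P)\<close> and \<open>(V P) (V P)\<^sup>*\<close> are \<open>P\<^sup>2\<close> and \<open>(V P V\<inverse>)\<^sup>2\<close>, and \<open>P\<close>
  and \<open>V P V\<inverse>\<close> are positive.
\<close>

lemma op_abs_isometry_comp:
  assumes V: "bounded_clinear V" "\<And>x y. cinner (V x) (V y) = cinner x y" "surj V"
    and P: "positive_op P"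
  shows "op_abs (V \<circ> P) = P" "op_abs (cadjoint (V \<circ> P)) = V \<circ> P \<circ> inv V"
proof -
  have V_inv: "V (inv V x) = x" for x
    using V(3) by (simp add: surj_f_inv_f)
  have cV: "cinner (V x) y = cinner x (inv V y)" for x y
    using V(2)[of x "inv V y"] by (simp add: V_inv)
  have inv_V: "inv V (V x) = x" for x
    by (rule cinner_eqI_right) (simp add: V(2) flip: cV)
  have cV': "cinner (inv V x) y = cinner x (V y)" for x y
    using V(2)[of "inv V x" y] by (simp add: V_inv)
  have bV: "bounded_clinear (inv V)"
  proof -
    have "cadjoint V = inv V"
      by (rule ext, rule cinner_eqI_right) (simp flip: cV bounded_clinear_cadjoint(2)[OF V(1)])
    with bounded_clinear_cadjoint(1)[OF V(1)] show ?thesis by simp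
  qed
  have bP: "bounded_clinear P" using P by (simp add: positive_op_def)
  have comp: "bounded_clinear (X \<circ> Y)" if "bounded_clinear X" "bounded_clinear Y" for X Y :: "'a \<Rightarrow> 'a"
    using that by (auto simp: bounded_clinear_def o_def intro: bounded_linear_compose)
  have adj: "cadjoint (V \<circ> P) = P \<circ> inv V"
    by (intro cadjoint_eqI comp bP bV) (simp add: cV positive_op_cinner_sym[OF P])
  then have "cadjoint (V \<circ> P) \<circ> (V \<circ> P) = P \<circ> P"
    by (simp add: fun_eq_iff inv_V)
  then show "op_abs (V \<circ> P) = P"
    using op_sqrt_square[OF P] by (simp add: op_abs_def)
  have pos: "positive_op (V \<circ> P \<circ> inv V)"
  proof (rule positive_opI)
    show "bounded_clinear (V \<circ> P \<circ> inv V)" by (intro comp V bP bV)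
    show "inner ((V \<circ> P \<circ> inv V) x) y = inner x ((V \<circ> P \<circ> inv V) y)" for x y
      by (simp add: inner_eq_Re_cinner cV cV' positive_op_cinner_sym[OF P])
    show "0 \<le> inner ((V \<circ> P \<circ> inv V) x) x" for x
      using P by (simp add: inner_eq_Re_cinner cV positive_op_def)
  qed
  have "cadjoint (cadjoint (V \<circ> P)) \<circ> cadjoint (V \<circ> P)
      = (V \<circ> P \<circ> inv V) \<circ> (V \<circ> P \<circ> inv V)"
    unfolding cadjoint_cadjoint[OF comp[OF V(1) bP]] unfolding adj
    by (simp add: fun_eq_iff inv_V)
  then show "op_abs (cadjoint (V \<circ> P)) = V \<circ> P \<circ> inv V"
    using op_sqrt_square[OF pos] by (simp only: op_abs_def)
qed

section \<open>Anti-unitary extensions\<close>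

text \<open>
  The graphs of maps between sets of vectors that treat inner products as an anti-unitary operator
  does.  That a graph is single-valued is implied: expanding \<open>\<parallel>y - y'\<parallel>\<^sup>2\<close> into inner products gives
  \<open>\<parallel>y - y'\<parallel> = \<parallel>x - x'\<parallel>\<close>.
\<close>

definition anti_isometric_pairs :: "('a::complex_inner \<times> 'a) set \<Rightarrow> bool"
  where "anti_isometric_pairs G \<longleftrightarrow>
    (\<forall>(x, y) \<in> G. \<forall>(x', y') \<in> G. cinner y y' = cinner x' x)"

definition total_set :: "'a::complex_inner set \<Rightarrow> bool"
  where "total_set A \<longleftrightarrow> (\<forall>z. (\<forall>a\<in>A. cinner a z = 0) \<longrightarrow> z = 0)"

text \<open>
  Zorn's lemma applies because a relation that is required of pairs passes to unions of chains.
\<close>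

lemma maximal_related_superset:
  assumes G: "\<forall>p\<in>G. \<forall>q\<in>G. R p q"
  shows "\<exists>H. G \<subseteq> H \<and> (\<forall>p\<in>H. \<forall>q\<in>H. R p q) \<and>
    (\<forall>p. R p p \<longrightarrow> (\<forall>q\<in>H. R p q \<and> R q p) \<longrightarrow> p \<in> H)"
proof -
  define A where "A = {H. G \<subseteq> H \<and> (\<forall>p\<in>H. \<forall>q\<in>H. R p q)}"
  have "\<exists>M\<in>A. \<forall>X\<in>A. M \<subseteq> X \<longrightarrow> X = M"
  proof (rule subset_Zorn_nonempty)
    fix \<C> assume \<C>: "\<C> \<noteq> {}" "subset.chain A \<C>"
    have "R p q" if pq: "p \<in> \<Union>\<C>" "q \<in> \<Union>\<C>" for p q
    proof -
      obtain X Y where "X \<in> \<C>" "p \<in> X" "Y \<in> \<C>" "q \<in> Y"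
        using pq by blast
      moreover from this have "X \<subseteq> Y \<or> Y \<subseteq> X"
        using \<C>(2) unfolding subset_chain_def by blast
      ultimately obtain Z where "Z \<in> \<C>" "p \<in> Z" "q \<in> Z"
        by blast
      with \<C>(2) show ?thesis unfolding subset_chain_def A_def by blast
    qed
    moreover have "G \<subseteq> \<Union>\<C>"
      using \<C> unfolding subset_chain_def A_def by blast
    ultimately show "\<Union>\<C> \<in> A" unfolding A_def by blast
  qed (use G in \<open>auto simp: A_def\<close>)
  then obtain H where H: "H \<in> A" and max: "\<forall>X\<in>A. H \<subseteq> X \<longrightarrow> X = H"
    by (rule bexE)
  have "p \<in> H" if "R p p" "\<forall>q\<in>H. R p q \<and> R q p" for p
  proof -
    have "insert p H \<in> A"
      using H that unfolding A_def by blast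
    with max show ?thesis by blast
  qed
  with H show ?thesis unfolding A_def by blast
qed

text \<open>
  A maximal set \<open>H\<close> of compatible pairs containing \<open>G\<close> contains every pair compatible with itself and
  with \<open>H\<close>, so it is closed under sums, under \<open>(x, y) \<mapsto> (a x, cnj a y)\<close> and under limits.  As it is the graph of an
  isometry and the space is complete, its domain is a closed subspace, which is everything since
  it contains a total set.
\<close>

lemma anti_isometric_pairs_extend:
  fixes G :: "('a::complex_hilbert \<times> 'a) set"
  assumes G: "anti_isometric_pairs G" and tot: "total_set (fst ` G)"
  obtains J where "antilinear J" "\<And>x y. cinner (J x) (J y) = cinner y x"
    "\<And>x y. (x, y) \<in> G \<Longrightarrow> J x = y"
proof -
  let ?R = "\<lambda>p q. cinner (snd p) (snd q) = cinner (fst q) (fst p)"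
  have "\<forall>p\<in>G. \<forall>q\<in>G. ?R p q"
    using G unfolding anti_isometric_pairs_def by fastforce
  from maximal_related_superset[OF this] obtain H where H: "G \<subseteq> H"
    and rel: "\<forall>p\<in>H. \<forall>q\<in>H. ?R p q"
    and max: "\<forall>p. ?R p p \<longrightarrow> (\<forall>q\<in>H. ?R p q \<and> ?R q p) \<longrightarrow> p \<in> H"
    by (elim exE conjE)
  have HD: "cinner y y' = cinner x' x" if "(x, y) \<in> H" "(x', y') \<in> H" for x y x' y'
    using rel[rule_format, OF that] by simp
  have HI: "(x, y) \<in> H"
    if compat: "\<And>x' y'. (x', y') \<in> H \<Longrightarrow> cinner y y' = cinner x' x"
      and self: "cinner y y = cinner x x" for x y
  proof (rule max[rule_format])
    fix q assume "q \<in> H"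
    then have "cinner y (snd q) = cinner (fst q) x"
      by (intro compat) simp
    moreover from this have "cinner (snd q) y = cinner x (fst q)"
      using cinner_commute[of "snd q" y] cinner_commute[of x "fst q"] by simp
    ultimately show "?R (x, y) q \<and> ?R q (x, y)" by simp
  qed (simp add: self)
  have add: "(x + x', y + y') \<in> H" if "(x, y) \<in> H" "(x', y') \<in> H" for x y x' y'
    using HD that by (intro HI) (simp_all add: cinner_add_left cinner_add_right add_ac)
  have scale: "(a *\<^sub>C x, cnj a *\<^sub>C y) \<in> H" if "(x, y) \<in> H" for a x y
    using HD that by (intro HI) (simp_all add: cinner_scaleC_left cinner_scaleC_right)
  have dist: "dist y y' = dist x x'" if "(x, y) \<in> H" "(x', y') \<in> H" for x y x' y'
  proof -
    have "(x - x', y - y') \<in> H"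
      using add[OF that(1) scale[OF that(2), of "-1"]] by (simp add: scaleC_minus_one)
    from HD[OF this this] show ?thesis
      by (simp add: cinner_self_eq_iff dist_norm)
  qed
  have "fst ` H = UNIV"
  proof (rule closed_subspace_eq_UNIV)
    have "(0, 0) \<in> H" by (rule HI) auto
    then show "subspace (fst ` H)"
    proof (intro subspaceI)
      fix x x' :: 'a and r :: real
      assume "x \<in> fst ` H"
      then obtain y where y: "(x, y) \<in> H" by auto
      from imageI[OF scale[OF y, of "complex_of_real r"], of fst] show "r *\<^sub>R x \<in> fst ` H"
        by (simp add: scaleC_of_real)
      assume "x' \<in> fst ` H"
      then obtain y' where "(x', y') \<in> H" by auto
      from imageI[OF add[OF y this], of fst] show "x + x' \<in> fst ` H" by simp
    qed force
    show "closed (fst ` H)"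
      unfolding closed_sequential_limits
    proof (intro allI impI, elim conjE)
      fix f x assume f: "\<forall>n. f n \<in> fst ` H" "f \<longlonglongrightarrow> x"
      have "\<exists>y. (f n, y) \<in> H" for n
        using f(1)[rule_format, of n] by auto
      then obtain g where g: "\<And>n. (f n, g n) \<in> H"
        by metis
      have "Cauchy g"
        using LIMSEQ_imp_Cauchy[OF f(2)] dist[OF g g] by (simp add: Cauchy_def)
      then obtain y where y: "g \<longlonglongrightarrow> y"
        using Cauchy_convergent convergent_def by blast
      have "(x, y) \<in> H"
      proof (rule HI)
        show "cinner y y' = cinner x' x" if "(x', y') \<in> H" for x' y'
        proof -
          have "cinner (g n) y' = cnj (cinner (f n) x')" for n
            using HD[OF g that] by (metis cinner_commute)
          then have "(\<lambda>n. cinner (g n) y') \<longlonglongrightarrow> cnj (cinner x x')"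
            by (simp only:) (intro tendsto_cnj tendsto_cinner_left f(2))
          from LIMSEQ_unique[OF tendsto_cinner_left[OF y] this] show ?thesis
            by (metis cinner_commute)
        qed
        have "norm (g n) = norm (f n)" for n
          using HD[OF g g, of n n] by (simp add: cinner_self_eq_iff)
        then have "norm y = norm x"
          using tendsto_norm[OF y] tendsto_norm[OF f(2)] LIMSEQ_unique by auto
        then show "cinner y y = cinner x x" by (simp add: cinner_self_eq_iff)
      qed
      then show "x \<in> fst ` H" by (rule image_eqI[rotated]) simp
    qed
    show "z = 0" if z: "\<And>m. m \<in> fst ` H \<Longrightarrow> inner z m = 0" for z
    proof -
      have "cinner z x = 0" if "(x, y) \<in> G" for x y
      proof -
        have "(x, y) \<in> H" using that H by blast
        with z[of x] z[of "\<i> *\<^sub>C x"] show ?thesis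
          using imageI[OF \<open>(x, y) \<in> H\<close>, of fst] imageI[OF scale[OF \<open>(x, y) \<in> H\<close>, of \<i>], of fst]
          by (simp add: cinner_eq_Complex_inner complex_eq_iff)
      qed
      then have "\<forall>x\<in>fst ` G. cinner x z = 0"
        by (auto simp: cinner_eq_0_commute[of _ z])
      with tot show ?thesis by (simp add: total_set_def)
    qed
  qed
  then have "\<exists>y. (x, y) \<in> H" for x
    using UNIV_I[of x] by (auto simp flip: \<open>fst ` H = UNIV\<close>)
  then obtain J where J: "\<And>x. (x, J x) \<in> H" by metis
  have J_eq: "J x = y" if "(x, y) \<in> H" for x y
    using dist[OF J[of x] that] by simp
  show ?thesis
  proof (rule that)
    show "antilinear J"
      using J_eq add scale J by (auto simp: antilinear_def)
    show "cinner (J x) (J y) = cinner y x" for x y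
      using HD J by blast
    show "J x = y" if "(x, y) \<in> G" for x y
      using J_eq that H by blast
  qed
qed

text \<open>
  Extending both \<open>G\<close> and its converse gives \<open>J\<close> and \<open>J'\<close>.  For \<open>(x, y) \<in> G\<close>,
  \<open>\<langle>J J' z, y\<rangle> = \<langle>J J' z, J x\<rangle> = \<langle>x, J' z\<rangle> = \<langle>J' y, J' z\<rangle> = \<langle>z, y\<rangle>\<close>, so totality of the second
  components makes \<open>J J'\<close> the identity and \<open>J\<close> surjective.
\<close>

lemma anti_unitary_extension:
  fixes G :: "('a::complex_hilbert \<times> 'a) set"
  assumes G: "anti_isometric_pairs G" and tot: "total_set (fst ` G)" "total_set (snd ` G)"
  obtains J where "anti_unitary J" "\<And>x y. (x, y) \<in> G \<Longrightarrow> J x = y"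
proof -
  obtain J where J: "antilinear J" "\<And>x y. cinner (J x) (J y) = cinner y x"
      "\<And>x y. (x, y) \<in> G \<Longrightarrow> J x = y"
    using anti_isometric_pairs_extend[OF G tot(1)] by blast
  have "anti_isometric_pairs (prod.swap ` G)"
    unfolding anti_isometric_pairs_def
  proof clarsimp
    fix x y x' y' assume "(x, y) \<in> G" "(x', y') \<in> G"
    with G have "cinner y' y = cinner x x'"
      unfolding anti_isometric_pairs_def by blast
    then show "cinner x x' = cinner y' y" by simp
  qed
  moreover have "total_set (fst ` prod.swap ` G)"
    using tot(2) by (simp add: image_comp)
  ultimately obtain J' where J': "\<And>x y. cinner (J' x) (J' y) = cinner y x"
      "\<And>x y. (y, x) \<in> prod.swap ` G \<Longrightarrow> J' y = x"
    using anti_isometric_pairs_extend by metis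
  have "J (J' z) = z" for z
  proof -
    have "cinner y (J (J' z) - z) = 0" if "(x, y) \<in> G" for x y
    proof -
      have "J x = y" "J' y = x"
        using J(3)[OF that] J'(2)[of y x] that by force+
      then have "cinner (J (J' z)) y = cinner z y"
        using J(2)[of "J' z" x] J'(1)[of y z] by simp
      then have "cinner (J (J' z) - z) y = 0"
        by (simp add: cinner_diff_left)
      then show ?thesis by (simp only: cinner_eq_0_commute)
    qed
    then have "\<forall>y\<in>snd ` G. cinner y (J (J' z) - z) = 0" by force
    then have "J (J' z) - z = 0"
      using tot(2) by (simp only: total_set_def)
    then show ?thesis by simp
  qed
  then have "surj J" by (metis surj_def)
  with J(1,2) have "anti_unitary J" by (simp add: anti_unitary_def)
  from that[OF this J(3)] show ?thesis .
qed

text \<open>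
  A vector of \<open>N\<close> orthogonal to \<open>F\<close> could be added to \<open>F\<close>, so it lies in \<open>F\<close> by maximality and is
  orthogonal to itself.  If \<open>N\<close> is a closed subspace, then \<open>F\<close> is the fixed-point set of a
  conjugation on \<open>N\<close>.
\<close>

lemma maximal_real_subset:
  fixes N :: "'a::complex_inner set"
  shows "\<exists>F\<subseteq>N. (\<forall>x\<in>F. \<forall>y\<in>F. cinner x y \<in> \<real>) \<and>
    (\<forall>z\<in>N. (\<forall>x\<in>F. cinner x z = 0) \<longrightarrow> z = 0)"
proof -
  let ?R = "\<lambda>x y. x \<in> N \<and> y \<in> N \<and> cinner x y \<in> \<real>"
  have "\<forall>x\<in>{}. \<forall>y\<in>{}. ?R x y" by simp
  from maximal_related_superset[OF this] obtain F where F: "\<forall>x\<in>F. \<forall>y\<in>F. ?R x y"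
    and max: "\<forall>x. ?R x x \<longrightarrow> (\<forall>y\<in>F. ?R x y \<and> ?R y x) \<longrightarrow> x \<in> F"
    by (elim exE conjE)
  have "z = 0" if z: "z \<in> N" "\<forall>x\<in>F. cinner x z = 0" for z
  proof -
    have "?R z z" using z(1) by (simp add: cinner_self)
    moreover have "\<forall>y\<in>F. ?R z y \<and> ?R y z"
      using F z z(2)[unfolded cinner_eq_0_commute[of _ z]] by simp
    ultimately have "z \<in> F" by (rule max[THEN spec, THEN mp, THEN mp])
    with z(2) have "cinner z z = 0" by blast
    then show ?thesis by (simp add: cinner_self)
  qed
  moreover have "F \<subseteq> N" using F by blast
  ultimately show ?thesis
    using F by (intro exI[of _ F] conjI ballI impI) simp_all
qed

section \<open>C-normal operators\<close>

lemma conjugation_anti_unitary_comp: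
  fixes C J :: "'a::complex_hilbert \<Rightarrow> 'a"
  assumes C: "conjugation C" and J: "anti_unitary J"
  shows "bounded_clinear (C \<circ> J)" "cinner ((C \<circ> J) x) ((C \<circ> J) y) = cinner x y"
    "surj (C \<circ> J)" "inv (C \<circ> J) = inv J \<circ> C" "J (inv J x) = x"
proof -
  have CC: "C (C x) = x" for x
    using C by (metis conjugation_def comp_apply id_apply)
  show iso: "cinner ((C \<circ> J) x) ((C \<circ> J) y) = cinner x y" for x y
    using C J by (simp add: conjugation_def anti_unitary_def)
  have add: "(C \<circ> J) (x + y) = (C \<circ> J) x + (C \<circ> J) y"
    and scale: "(C \<circ> J) (a *\<^sub>C x) = a *\<^sub>C (C \<circ> J) x" for a x y
    using C J by (auto simp: conjugation_def anti_unitary_def antilinear_def)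
  have "norm ((C \<circ> J) x) = norm x" for x
    using iso[of x x] by (simp only: cinner_self_eq_iff)
  then have "bounded_linear (C \<circ> J)"
    using add scale[of "complex_of_real _"]
    by (intro bounded_linear_intro[where K = 1]) (simp_all add: scaleC_of_real)
  with scale show "bounded_clinear (C \<circ> J)"
    by (simp add: bounded_clinear_def)
  show J_inv: "J (inv J x) = x" for x
    using J by (simp add: anti_unitary_def surj_f_inv_f)
  then have "(C \<circ> J) ((inv J \<circ> C) x) = x" for x
    by (simp add: CC)
  moreover have "inj (C \<circ> J)"
  proof (rule injI)
    fix x y assume "(C \<circ> J) x = (C \<circ> J) y"
    then have "cinner x z = cinner y z" for z
      by (metis iso)
    then show "x = y" by (rule cinner_eqI)
  qed
  ultimately show "surj (C \<circ> J)" "inv (C \<circ> J) = inv J \<circ> C"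
    by (metis surj_def) (rule ext, rule inv_f_eq[OF \<open>inj (C \<circ> J)\<close>], fact)
qed

text \<open>
  The operator \<open>J\<close> maps \<open>\<bar>T\<bar>x\<close> to \<open>C T x\<close> and fixes a maximal real subset \<open>F\<close> of the kernel of \<open>\<bar>T\<bar>\<close>.
  These prescriptions are compatible and total on both sides, because by C-normality this kernel is
  the orthogonal complement of the range of \<open>C T\<close> as well as of the range of \<open>\<bar>T\<bar>\<close>.
\<close>

lemma C_normal_imp_anti_unitary:
  assumes C: "conjugation C" and T: "C_normal C T"
  obtains J where "anti_unitary J" "T = C \<circ> J \<circ> op_abs T"
proof -
  let ?P = "op_abs T"
  have bT: "bounded_clinear T" and normal: "C (?P (C x)) = op_abs (cadjoint T) x" for x
    using T by (auto simp: C_normal_def fun_eq_iff)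
  note bT' = bounded_clinear_cadjoint(1)[OF bT]
  have CC: "C (C x) = x" and C_iso: "cinner (C x) (C y) = cinner y x" for x y
    using C by (auto simp: conjugation_def fun_eq_iff)
  have C_swap: "cinner (C x) y = cinner (C y) x" for x y
    using C_iso[of x "C y"] by (simp add: CC)
  have C0: "C x = 0 \<longleftrightarrow> x = 0" for x
    using C_iso[of x x] by (metis cinner_self_eq_iff norm_eq_zero)
  note P_sym = positive_op_cinner_sym[OF op_abs(1)[OF bT]]
  have ker_P: "?P z = 0 \<longleftrightarrow> (\<forall>x. cinner (?P x) z = 0)" for z
    by (simp add: P_sym eq_0_iff_cinner[of "?P z"])
  have ker_CT: "?P z = 0 \<longleftrightarrow> (\<forall>x. cinner (C (T x)) z = 0)" for z
  proof -
    have "?P z = 0 \<longleftrightarrow> op_abs (cadjoint T) (C z) = 0"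
      using normal[of "C z"] by (simp add: CC flip: C0[of "?P z"])
    also have "\<dots> \<longleftrightarrow> cadjoint T (C z) = 0"
      by (rule op_abs_eq_0_iff[OF bT'])
    also have "\<dots> \<longleftrightarrow> (\<forall>x. cinner x (cadjoint T (C z)) = 0)"
      by (rule eq_0_iff_cinner)
    also have "\<dots> \<longleftrightarrow> (\<forall>x. cinner (C (T x)) z = 0)"
      by (simp add: C_swap[of z] cinner_eq_0_commute[of "T _" "C z"]
          flip: bounded_clinear_cadjoint(2)[OF bT])
    finally show ?thesis .
  qed
  obtain F where F: "F \<subseteq> {z. ?P z = 0}" "\<forall>x\<in>F. \<forall>y\<in>F. cinner x y \<in> \<real>"
      "\<forall>z\<in>{z. ?P z = 0}. (\<forall>x\<in>F. cinner x z = 0) \<longrightarrow> z = 0"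
    using maximal_real_subset[of "{z. ?P z = 0}"] by (elim exE conjE)
  define G where "G = range (\<lambda>x. (?P x, C (T x))) \<union> (\<lambda>e. (e, e)) ` F"
  have "anti_isometric_pairs G"
  proof -
    have 1: "cinner (C (T x)) (C (T x')) = cinner (?P x') (?P x)" for x x'
      by (simp add: C_iso cinner_op_abs[OF bT])
    have 2: "cinner (C (T x)) e = 0" "cinner (?P x) e = 0" if "e \<in> F" for x e
      using F(1) that ker_P[of e] ker_CT[of e] by auto
    have 3: "cinner e (C (T x)) = 0" "cinner e (?P x) = 0" if "e \<in> F" for x e
      using 2[OF that] by (simp only: cinner_eq_0_commute)+
    have 4: "cinner e e' = cinner e' e" if "e \<in> F" "e' \<in> F" for e e'
      using F(2) that cinner_commute[of e e'] by (simp add: Reals_cnj_iff)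
    show ?thesis
      unfolding anti_isometric_pairs_def G_def using 1 2 3 4 by auto
  qed
  moreover have "total_set (fst ` G)" "total_set (snd ` G)"
    unfolding total_set_def G_def
    by (auto simp: ball_Un image_Un image_image ker_P[symmetric] ker_CT[symmetric] intro!: F(3)[rule_format])
  ultimately obtain J where J: "anti_unitary J" "\<And>x y. (x, y) \<in> G \<Longrightarrow> J x = y"
    using anti_unitary_extension by blast
  have "J (?P x) = C (T x)" for x
    by (rule J(2)) (simp add: G_def)
  then have "T = C \<circ> J \<circ> ?P"
    by (simp add: fun_eq_iff CC)
  with J(1) that show ?thesis by blast
qed

text \<open>
  With \<open>V = C J\<close>, C-normality of \<open>V P\<close> reads \<open>C P C = V P V\<inverse> = C (J P J\<inverse>) C\<close>.
\<close>

lemma C_normal_iff_commute: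
  assumes C: "conjugation C" and J: "anti_unitary J" and P: "positive_op P"
  shows "C_normal C (C \<circ> J \<circ> P) \<longleftrightarrow> J \<circ> P = P \<circ> J"
proof -
  let ?V = "C \<circ> J"
  note V = conjugation_anti_unitary_comp[OF C J]
  have CC: "C (C x) = x" for x
    using C by (metis conjugation_def comp_apply id_apply)
  have "bounded_clinear (?V \<circ> P)"
    using V(1) P by (auto simp: positive_op_def bounded_clinear_def o_def intro: bounded_linear_compose)
  then have "C_normal C (?V \<circ> P) \<longleftrightarrow> C \<circ> P \<circ> C = ?V \<circ> P \<circ> (inv J \<circ> C)"
    using op_abs_isometry_comp[OF V(1,2,3) P] V(4) by (simp add: C_normal_def)
  also have "\<dots> \<longleftrightarrow> (\<forall>x. P x = J (P (inv J x)))"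
  proof
    assume "C \<circ> P \<circ> C = C \<circ> J \<circ> P \<circ> (inv J \<circ> C)"
    then have "C (P (C x)) = C (J (P (inv J (C x))))" for x
      by (simp add: fun_eq_iff)
    then have "C (C (P (C (C x)))) = C (C (J (P (inv J (C (C x))))))" for x
      by simp
    then show "\<forall>x. P x = J (P (inv J x))" unfolding CC by blast
  next
    assume "\<forall>x. P x = J (P (inv J x))"
    then show "C \<circ> P \<circ> C = C \<circ> J \<circ> P \<circ> (inv J \<circ> C)"
      unfolding fun_eq_iff comp_apply by metis
  qed
  also have "\<dots> \<longleftrightarrow> J \<circ> P = P \<circ> J"
  proof -
    have "inj J"
    proof (rule injI)
      fix x y assume "J x = J y"
      moreover have "cinner u z = cinner (J z) (J u)" for u z
        using J by (simp add: anti_unitary_def)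
      ultimately have "cinner x z = cinner y z" for z by metis
      then show "x = y" by (rule cinner_eqI)
    qed
    then have "inv J (J x) = x" for x by simp
    with V(5) show ?thesis
      unfolding fun_eq_iff comp_apply by metis
  qed
  finally show ?thesis .
qed

theorem theorem4p17:
  fixes C :: "'a::complex_hilbert \<Rightarrow> 'a"
  assumes separable: "\<exists>D::'a set. countable D \<and> closure D = UNIV"
    and C: "conjugation C"
  shows "C_normal_ops C =
    {C \<circ> J \<circ> P | J P. positive_op P \<and> anti_unitary J \<and> J \<circ> P = P \<circ> J}"
proof (intro set_eqI iffI)
  fix T assume "T \<in> C_normal_ops C"
  then have T: "C_normal C T" by (simp add: C_normal_ops_def)
  obtain J where J: "anti_unitary J" "T = C \<circ> J \<circ> op_abs T"
    using C_normal_imp_anti_unitary[OF C T] .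
  have P: "positive_op (op_abs T)"
    using T op_abs(1) by (auto simp: C_normal_def)
  have "J \<circ> op_abs T = op_abs T \<circ> J"
    using C_normal_iff_commute[OF C J(1) P] T J(2) by simp
  with J P show "T \<in> {C \<circ> J \<circ> P | J P. positive_op P \<and> anti_unitary J \<and> J \<circ> P = P \<circ> J}"
    by blast
next
  fix T assume "T \<in> {C \<circ> J \<circ> P | J P. positive_op P \<and> anti_unitary J \<and> J \<circ> P = P \<circ> J}"
  then show "T \<in> C_normal_ops C"
    using C_normal_iff_commute[OF C] by (auto simp: C_normal_ops_def)
qed

end
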